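(* Let $s\in(s_0,1]$ and let $(U^n)_{n\ge0}\subset\mathbb R^{N-1}$ be a numerical solution of the modified finite element Crank--Nicolson scheme $$\frac{U^{n+1}-U^n}{\tau}+\frac{\epsilon^2}{2h}\,\boldsymbol S\,(U^{n+1}+U^n)+\frac12\big(f(U^{n+1})+f(U^n)\big)=0,\qquad n\ge0,$$ with initial value $U^0_j=u_0(x_j)$, $1\le j\le N-1$. If $0\le u_0(x)\le1$, then the scheme preserves the maximum principle in the sense that $0\le U^n_j\le1$ for all $n\ge1$ and $j=1,2,\dots,N-1$, provided that the time step size satisfies $$0<\tau\le\min\Big\{2,\frac{h^{2s}}{2\epsilon^2}\Big\}.$$
   Context: Let $\Omega=(a,b)$, $N\ge2$ an integer, $h=(b-a)/N$, $x_j=a+jh$, and $\epsilon>0$ a constant. $s_0\approx0.2374$ is the unique root in $(0,\frac12)$ of $7+3^{3-2s}-2^{5-2s}=0$. $f(u)=\frac{u(u-1)(2u-1)}2$, applied componentwise to vectors. $\boldsymbol S$ is the $(N-1)\times(N-1)$ stiffness matrix of the fractional Laplacian for piecewise linear finite elements: for $s\ne\frac12$, $S_{kj}=\frac{h^{1-2s}}{2\Gamma(4-2s)\cos(s\pi)}\,t_{|k-j|}$ with $t_p=\sum_{i=-2}^2c_i|p+i|^{3-2s}$, $c_0=6$, $c_{\pm1}=-4$, $c_{\pm2}=1$; for $s=\frac12$, $S_{kj}=\frac1{2\pi}\sum_{i=-2}^2c_i(p+i)^2\ln|p+i|$ with $p=|k-j|$ and $0^2\ln0=0$. The scheme is the matrix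 form, with $U^n=(u_h^n(x_1),\dots,u_h^n(x_{N-1}))^T$, of: find $u_h^{n+1}$ in the span of the hat functions with $\frac1\tau(I_h((u_h^{n+1}-u_h^n)v_h),1)_\Omega+\epsilon^2(\frac{(-\Delta)^su_h^{n+1}+(-\Delta)^su_h^n}2,v_h)_\Omega+(I_h(\frac{f(u_h^{n+1})+f(u_h^n)}2v_h),1)_\Omega=0$ for all $v_h$ in that span, where $I_h$ is piecewise linear nodal interpolation at $x_1,\dots,x_{N-1}$; it discretizes $u_t+\epsilon^2(-\Delta)^su+f(u)=0$ in $\Omega$, $u=0$ on $\mathbb R\setminus\Omega$, $u(\cdot,0)=u_0$. *)

theory Defs
  imports "HOL-Analysis.Analysis" "Jordan_Normal_Form.Matrix"
begin

unbundle no vec_syntax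

definition s0_eq :: "real \<Rightarrow> real" where
  "s0_eq s = 7 + 3 powr (3 - 2 * s) - 2 powr (5 - 2 * s)"

definition s0 :: real where
  "s0 = (THE s. 0 < s \<and> s < 1/2 \<and> s0_eq s = 0)"

lemma s0_eq_has_derivative:
  "(s0_eq has_real_derivative
     2 * ln 2 * 2 powr (5 - 2 * s) - 2 * ln 3 * 3 powr (3 - 2 * s)) (at s)"
  unfolding s0_eq_def by (auto intro!: derivative_eq_intros)

lemma s0_eq_critical_unique:
  assumes "2 * ln 2 * 2 powr (5 - 2 * s) = 2 * ln 3 * 3 powr (3 - 2 * s)"
    and "2 * ln 2 * 2 powr (5 - 2 * t) = 2 * ln 3 * 3 powr (3 - 2 * t)"
  shows "s = (t :: real)"
proof -
  have key: "(5 - 2 * r) * ln 2 + ln (ln 2) = (3 - 2 * r) * ln 3 + ln (ln (3::real))"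
    if "2 * ln 2 * 2 powr (5 - 2 * r) = 2 * ln 3 * 3 powr (3 - 2 * r)" for r :: real
  proof -
    have "ln (ln 2 * 2 powr (5 - 2 * r)) = ln (ln 3 * 3 powr (3 - 2 * r))"
      using that by simp
    then show ?thesis by (simp add: ln_mult ln_powr)
  qed
  have "(s - t) * (ln 3 - ln 2) = 0"
    using key[OF assms(1)] key[OF assms(2)] by (simp add: algebra_simps)
  then show ?thesis by auto
qed

lemma s0_eq_half: "s0_eq (1/2) = 0"
  by (simp add: s0_eq_def)

lemma s0_unique: "\<exists>!s. 0 < s \<and> s < 1/2 \<and> s0_eq s = 0"
proof -
  have cont: "continuous_on A s0_eq" for A
    by (rule DERIV_continuous_on, rule has_field_derivative_at_within, rule s0_eq_has_derivative)
  have uniq: False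
    if st: "0 < s" "s < t" "t < 1/2" "s0_eq s = 0" "s0_eq t = 0" for s t
  proof -
    obtain y where y: "s < y" "y < t"
      "2 * ln 2 * 2 powr (5 - 2 * y) - 2 * ln 3 * 3 powr (3 - 2 * y) = 0"
      using MVT2[OF st(2), of s0_eq, OF s0_eq_has_derivative] st by auto
    obtain z where z: "t < z" "z < 1/2"
      "2 * ln 2 * 2 powr (5 - 2 * z) - 2 * ln 3 * 3 powr (3 - 2 * z) = 0"
      using MVT2[OF st(3), of s0_eq, OF s0_eq_has_derivative] st s0_eq_half by auto
    show False using s0_eq_critical_unique[of y z] y z by simp
  qed
  have at0: "s0_eq 0 > 0" by (simp add: s0_eq_def)
  have at1: "s0_eq (1/4) < 0"
  proof -
    have three: "(3::real) powr (5/2) = 9 * sqrt 3"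
      using powr_add[of "3::real" 2 "1/2"] by (simp add: powr_half_sqrt)
    have two: "(2::real) powr (9/2) = 16 * sqrt 2"
      using powr_add[of "2::real" 4 "1/2"] by (simp add: powr_half_sqrt)
    have "sqrt 3 < 1733 / 1000"
      by (rule real_less_lsqrt) (simp_all add: power2_eq_square)
    moreover have "1414 / 1000 < sqrt 2"
      by (rule real_less_rsqrt) (simp add: power2_eq_square)
    ultimately show ?thesis using three two by (simp add: s0_eq_def)
  qed
  obtain s where s: "0 \<le> s" "s \<le> 1/4" "s0_eq s = 0"
    using IVT2'[of s0_eq "1/4" 0 0] at0 at1 cont by auto
  have "s \<noteq> 0" using s at0 by auto
  then have "0 < s \<and> s < 1/2 \<and> s0_eq s = 0" using s by auto
  then have "\<exists>s. 0 < s \<and> s < 1/2 \<and> s0_eq s = 0" by blast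
  moreover have "s = t" if "0 < s \<and> s < 1/2 \<and> s0_eq s = 0" "0 < t \<and> t < 1/2 \<and> s0_eq t = 0" for s t
    using uniq[of s t] uniq[of t s] that by (cases s t rule: linorder_cases) auto
  ultimately show ?thesis by blast
qed

definition mesh_size :: "real \<Rightarrow> real \<Rightarrow> nat \<Rightarrow> real" where
  "mesh_size a b N = (b - a) / real N"

definition node :: "real \<Rightarrow> real \<Rightarrow> nat \<Rightarrow> nat \<Rightarrow> real" where
  "node a b N j = a + real j * mesh_size a b N"

definition f :: "real \<Rightarrow> real" where
  "f u = u * (u - 1) * (2 * u - 1) / 2"

definition stencil :: "int \<Rightarrow> real" where
  "stencil i = (if i = 0 then 6 else if \<bar>i\<bar> = 1 then -4 else if \<bar>i\<bar> = 2 then 1 else 0)"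

(* The library conventions ln 0 = 0 and 0 powr x = 0 give the intended value 0 to the
   terms with p + i = 0. *)
definition stiffness_entry :: "real \<Rightarrow> real \<Rightarrow> int \<Rightarrow> real" where
  "stiffness_entry s h p =
     (if s = 1/2
      then 1 / (2 * pi) *
        (\<Sum>i\<in>{-2..2}. stencil i * (real_of_int (p + i))\<^sup>2 * ln \<bar>real_of_int (p + i)\<bar>)
      else h powr (1 - 2 * s) / (2 * Gamma (4 - 2 * s) * cos (s * pi)) *
        (\<Sum>i\<in>{-2..2}. stencil i * \<bar>real_of_int (p + i)\<bar> powr (3 - 2 * s)))"

(* Rows, columns and vector components are 0-based: index i belongs to the node i + 1.
   The entries depend on index differences only. *)
definition stiffness_matrix :: "real \<Rightarrow> real \<Rightarrow> nat \<Rightarrow> real mat" where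
  "stiffness_matrix s h N =
     mat (N - 1) (N - 1) (\<lambda>(k, j). stiffness_entry s h \<bar>int k - int j\<bar>)"

end

theory Submission
  imports Defs "HOL-Real_Asymp.Real_Asymp"
begin

text \<open>
  Write one step of the scheme with \<open>W\<close> for the old and \<open>V\<close> for the new vector, and let
  \<open>\<kappa> = \<tau> \<epsilon>\<^sup>2 / (2 h)\<close>. Let \<open>j\<close> be an index where \<open>V\<close> is minimal and suppose that \<open>V\<^sub>j < 0\<close>.
  Everything rests on three properties of the stiffness matrix: its off-diagonal entries are
  nonpositive, its row sums are nonnegative, and its diagonal entry is at most \<open>2 h\<close> to the
  power \<open>1 - 2 s\<close>. The first two give \<open>(S V)\<^sub>j \<le> 0\<close> and
  \<open>(S W)\<^sub>j \<le> S\<^sub>j\<^sub>j W\<^sub>j\<close>, and the third says that the restriction on \<open>\<tau>\<close> makes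
  \<open>\<kappa> S\<^sub>j\<^sub>j \<le> 1/2\<close>. The diffusion term is therefore at most \<open>W\<^sub>j / 2\<close>. As
  \<open>f (W\<^sub>j) \<le> W\<^sub>j / 2\<close>, \<open>f (V\<^sub>j) \<le> 0\<close> and \<open>\<tau> \<le> 2\<close>, the reaction term is also at most
  \<open>W\<^sub>j / 2\<close>, so that the residual at \<open>j\<close> is at most \<open>V\<^sub>j < 0\<close>, contrary to the scheme
  (\<open>supersolution_nonneg\<close>). The argument needs a nonnegative residual only. Since \<open>f\<close> is odd
  about \<open>1/2\<close> and row sums are nonnegative, \<open>1 - V\<close> has nonnegative residual as well, and the
  upper bound follows from the lower one (\<open>crank_nicolson_step_bounds\<close>).

  The signs of the matrix entries come from a single kernel. The entry at distance \<open>p\<close> is the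
  fourth central difference at \<open>p\<close> of \<open>\<phi> \<bar>y\<bar>\<close>, where \<open>\<phi> y\<close> is a multiple of \<open>y\<close> to the
  power \<open>3 - 2 s\<close>, or of \<open>y\<^sup>2 ln y\<close> when \<open>s = 1/2\<close>. In all cases \<open>\<phi>'''\<close> is nonnegative and
  nonincreasing on the positive half-line, because the sign of \<open>cos (s \<pi>)\<close> compensates the sign
  of \<open>1 - 2 s\<close>. Nonincreasing \<open>\<phi>'''\<close> makes the fourth differences at \<open>p \<ge> 2\<close> nonpositive.
  Nonnegative \<open>\<phi>'''\<close> makes third differences nonnegative, and the sum of a row over a symmetric
  range telescopes to twice a third difference. The stencil at \<open>p = 1\<close> crosses the kink of
  \<open>\<bar>y\<bar>\<close> at the origin and has to be treated by hand; its sign for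
  \<open>s \<noteq> 1/2\<close> is that of \<open>s0_eq s / cos (s \<pi>)\<close>, which is where the threshold \<open>s0\<close> enters (\<open>s0_eq_neg\<close>,
  \<open>s0_eq_pos\<close>). The diagonal bound (\<open>kernel_coefficient_bound\<close>) is an equality at \<open>s = 1\<close> and
  follows from the convexity of \<open>2\<close> to the power \<open>u\<close>, the concavity of the sine and crude
  lower bounds for the Gamma function.
\<close>

section \<open>Difference stencils of kernels with monotone third derivative\<close>

text \<open>
  Differentiability is required only beyond the left end point \<open>c\<close>, since the kernels below have
  no second derivative at the origin, which the stencil at distance \<open>2\<close> touches.
\<close>

lemma second_difference_nonneg:
  fixes g g' :: "real \<Rightarrow> real"
  assumes cont: "continuous_on {c..} g"
    and deriv: "\<And>y. c < y \<Longrightarrow> (g has_real_derivative g' y) (at y)"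
    and mono: "\<And>y z. c < y \<Longrightarrow> y \<le> z \<Longrightarrow> g' y \<le> g' z"
    and y: "c + 1 \<le> y"
  shows "0 \<le> g (y + 1) - 2 * g y + g (y - 1)"
proof -
  have mvt: "\<exists>z. l < z \<and> z < r \<and> g r - g l = (r - l) * g' z" if "c \<le> l" "l < r" for l r
  proof -
    have "g differentiable (at z)" if "l < z" for z
      using deriv[of z] that \<open>c \<le> l\<close> by (auto simp: real_differentiable_def)
    moreover have "continuous_on {l..r} g"
      using that by (intro continuous_on_subset[OF cont]) auto
    ultimately obtain D z where "l < z" "z < r" "DERIV g z :> D" "g r - g l = (r - l) * D"
      using MVT[of l r g] \<open>l < r\<close> by metis
    moreover have "D = g' z"
      using DERIV_unique[OF \<open>DERIV g z :> D\<close> deriv[of z]] \<open>l < z\<close> that by simp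
    ultimately show ?thesis by blast
  qed
  obtain z1 where z1: "y - 1 < z1" "z1 < y" "g y - g (y - 1) = g' z1"
    using mvt[of "y - 1" y] y by auto
  obtain z2 where z2: "y < z2" "g (y + 1) - g y = g' z2"
    using mvt[of y "y + 1"] y by auto
  show ?thesis using mono[of z1 z2] z1 z2 y by simp
qed

text \<open>
  The functions \<open>\<phi>1\<close>, \<open>\<phi>2\<close>, \<open>\<phi>3\<close> are the first three derivatives of \<open>\<phi>\<close>. The last
  assumption is the sign of the matrix entry at distance \<open>1\<close>, where one stencil point lies on the
  other side of the origin, so that derivatives of \<open>\<phi>\<close> give no information.
\<close>

locale stencil_kernel =
  fixes \<phi> \<phi>1 \<phi>2 \<phi>3 :: "real \<Rightarrow> real"
  assumes continuous: "continuous_on {0..} \<phi>"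
    and deriv1: "\<And>y. 0 < y \<Longrightarrow> (\<phi> has_real_derivative \<phi>1 y) (at y)"
    and deriv2: "\<And>y. 0 < y \<Longrightarrow> (\<phi>1 has_real_derivative \<phi>2 y) (at y)"
    and deriv3: "\<And>y. 0 < y \<Longrightarrow> (\<phi>2 has_real_derivative \<phi>3 y) (at y)"
    and third_nonneg: "\<And>y. 0 < y \<Longrightarrow> 0 \<le> \<phi>3 y"
    and third_antimono: "\<And>y z. 0 < y \<Longrightarrow> y \<le> z \<Longrightarrow> \<phi>3 z \<le> \<phi>3 y"
    and nearest_neighbour: "\<phi> 3 - 4 * \<phi> 2 + 7 * \<phi> 1 - 4 * \<phi> 0 \<le> 0"
begin

definition entry :: "int \<Rightarrow> real" where
  "entry p = (\<Sum>i\<in>{-2..2}. stencil i * \<phi> \<bar>real_of_int (p + i)\<bar>)"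

lemma entry_eq:
  "entry p = \<phi> \<bar>real_of_int (p - 2)\<bar> - 4 * \<phi> \<bar>real_of_int (p - 1)\<bar> + 6 * \<phi> \<bar>real_of_int p\<bar>
    - 4 * \<phi> \<bar>real_of_int (p + 1)\<bar> + \<phi> \<bar>real_of_int (p + 2)\<bar>"
proof -
  have "{-2..2} = {-2, -1, 0, 1, 2::int}" by auto
  then show ?thesis by (simp add: entry_def stencil_def)
qed

lemma second_derivative_mono:
  assumes "0 < y" "y \<le> z" shows "\<phi>2 y \<le> \<phi>2 z"
  by (rule DERIV_nonneg_imp_nondecreasing[where f = \<phi>2, OF assms(2)])
     (meson assms(1) deriv3 third_nonneg order_less_le_trans)

text \<open>This is the concavity of \<open>\<phi>2\<close>, as its derivative \<open>\<phi>3\<close> is nonincreasing.\<close>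

lemma second_derivative_concave:
  assumes "1 < y" shows "\<phi>2 (y + 1) - 2 * \<phi>2 y + \<phi>2 (y - 1) \<le> 0"
proof -
  \<comment> \<open>Any \<open>c\<close> strictly between \<open>0\<close> and \<open>y - 1\<close> keeps the argument away from the singularity of
    \<open>\<phi>2\<close> at the origin.\<close>
  define c where "c = (y - 1) / 2"
  have c: "0 < c" "c + 1 \<le> y" using assms by (auto simp: c_def field_simps)
  have "0 \<le> (- \<phi>2 (y + 1)) - 2 * (- \<phi>2 y) + (- \<phi>2 (y - 1))"
  proof (rule second_difference_nonneg[where g' = "\<lambda>y. - \<phi>3 y" and c = c])
    show "continuous_on {c..} (\<lambda>y. - \<phi>2 y)"
      by (rule DERIV_continuous_on[where D = "\<lambda>y. - \<phi>3 y"], rule has_field_derivative_at_within)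
         (use c deriv3 in \<open>auto intro!: DERIV_minus\<close>)
  qed (use c deriv3 third_antimono in \<open>auto intro!: DERIV_minus\<close>)
  then show ?thesis by simp
qed

lemma deriv1_shift:
  "0 < y + d \<Longrightarrow> ((\<lambda>y. \<phi> (y + d)) has_real_derivative \<phi>1 (y + d)) (at y)"
  using deriv1 by (intro DERIV_shift[THEN iffD1])

lemma deriv2_shift:
  "0 < y + d \<Longrightarrow> ((\<lambda>y. \<phi>1 (y + d)) has_real_derivative \<phi>2 (y + d)) (at y)"
  using deriv2 by (intro DERIV_shift[THEN iffD1])

lemma continuous_shift: "- d \<le> c \<Longrightarrow> continuous_on {c..} (\<lambda>y. \<phi> (y + d))"
  by (rule continuous_on_compose2[OF continuous]) (auto intro!: continuous_intros)

text \<open>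
  The fourth difference is the second difference of \<open>- G\<close>, where \<open>- G\<close> is itself the second
  difference of \<open>\<phi>\<close>; and \<open>G\<close> is convex because \<open>\<phi>2\<close> is concave.
\<close>

lemma fourth_difference_nonpos:
  assumes "2 \<le> y"
  shows "\<phi> (y + 2) - 4 * \<phi> (y + 1) + 6 * \<phi> y - 4 * \<phi> (y - 1) + \<phi> (y - 2) \<le> 0"
proof -
  define G where "G y = - (\<phi> (y + 1) - 2 * \<phi> (y + 0) + \<phi> (y + (-1)))" for y
  define G' where "G' y = - (\<phi>1 (y + 1) - 2 * \<phi>1 (y + 0) + \<phi>1 (y + (-1)))" for y
  define G'' where "G'' y = - (\<phi>2 (y + 1) - 2 * \<phi>2 (y + 0) + \<phi>2 (y + (-1)))" for y
  have "0 \<le> G (y + 1) - 2 * G y + G (y - 1)"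
  proof (rule second_difference_nonneg[where g' = G' and c = 1])
    show "continuous_on {1..} G"
      unfolding G_def by (intro continuous_intros continuous_shift) auto
    show "(G has_real_derivative G' y) (at y)" if "1 < y" for y
      unfolding G_def G'_def using that
      by (intro DERIV_minus DERIV_add DERIV_diff DERIV_cmult deriv1_shift) auto
    have G'': "(G' has_real_derivative G'' y) (at y)" if "1 < y" for y
      unfolding G'_def G''_def using that
      by (intro DERIV_minus DERIV_add DERIV_diff DERIV_cmult deriv2_shift) auto
    have G''_nonneg: "0 \<le> G'' y" if "1 < y" for y
      unfolding G''_def using second_derivative_concave[OF that] by simp
    show "G' y \<le> G' z" if "1 < y" "y \<le> z" for y z
      by (rule DERIV_nonneg_imp_nondecreasing[where f = G', OF that(2)])
         (meson that G'' G''_nonneg order_less_le_trans)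
  qed (use assms in simp)
  then show ?thesis by (simp add: G_def algebra_simps)
qed

text \<open>
  The third difference is the second difference of the forward difference \<open>G\<close>, which is convex
  because \<open>\<phi>2\<close> is nondecreasing.
\<close>

lemma third_difference_nonneg:
  assumes "1 \<le> y"
  shows "0 \<le> \<phi> (y + 2) - 3 * \<phi> (y + 1) + 3 * \<phi> y - \<phi> (y - 1)"
proof -
  define G where "G y = \<phi> (y + 1) - \<phi> (y + 0)" for y
  define G' where "G' y = \<phi>1 (y + 1) - \<phi>1 (y + 0)" for y
  define G'' where "G'' y = \<phi>2 (y + 1) - \<phi>2 (y + 0)" for y
  have "0 \<le> G (y + 1) - 2 * G y + G (y - 1)"
  proof (rule second_difference_nonneg[where g' = G' and c = 0])
    show "continuous_on {0..} G"
      unfolding G_def by (intro continuous_intros continuous_shift) auto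
    show "(G has_real_derivative G' y) (at y)" if "0 < y" for y
      unfolding G_def G'_def using that
      by (intro DERIV_diff deriv1_shift) auto
    have G'': "(G' has_real_derivative G'' y) (at y)" if "0 < y" for y
      unfolding G'_def G''_def using that
      by (intro DERIV_diff deriv2_shift) auto
    have G''_nonneg: "0 \<le> G'' y" if "0 < y" for y
      unfolding G''_def using second_derivative_mono[of y "y + 1"] that by simp
    show "G' y \<le> G' z" if "0 < y" "y \<le> z" for y z
      by (rule DERIV_nonneg_imp_nondecreasing[where f = G', OF that(2)])
         (meson that G'' G''_nonneg order_less_le_trans)
  qed (use assms in simp)
  then show ?thesis by (simp add: G_def algebra_simps)
qed

lemma entry_nonpos:
  assumes "1 \<le> p" shows "entry p \<le> 0"
proof (cases "p = 1")
  case True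
  then show ?thesis using nearest_neighbour by (simp add: entry_eq)
next
  case False
  then have "2 \<le> p" using assms by simp
  then show ?thesis
    using fourth_difference_nonpos[of "real_of_int p"] by (simp add: entry_eq)
qed

text \<open>
  The fourth differences telescope to third differences at the two ends of the range, which agree
  by symmetry. The absolute value on the right matters for \<open>M = 0\<close>, the start of the induction.
\<close>

lemma entry_sum:
  "(\<Sum>p\<in>{- int M..int M}. entry \<bar>p\<bar>) =
    2 * (\<phi> (real M + 2) - 3 * \<phi> (real M + 1) + 3 * \<phi> (real M) - \<phi> \<bar>real M - 1\<bar>)"
proof (induction M)
  case 0
  then show ?case by (simp add: entry_eq)
next
  case (Suc M)
  have "{- int (Suc M)..int (Suc M)} = {- int M..int M} \<union> {int M + 1, - (int M + 1)}"
    by auto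
  then have "(\<Sum>p\<in>{- int (Suc M)..int (Suc M)}. entry \<bar>p\<bar>) =
      (\<Sum>p\<in>{- int M..int M}. entry \<bar>p\<bar>) + (\<Sum>p\<in>{int M + 1, - (int M + 1)}. entry \<bar>p\<bar>)"
    by (simp only:) (rule sum.union_disjoint, auto)
  also have "(\<Sum>p\<in>{int M + 1, - (int M + 1)}. entry \<bar>p\<bar>) = 2 * entry (int M + 1)"
    by (simp add: add.commute)
  also have "entry (int M + 1) = \<phi> \<bar>real M - 1\<bar> - 4 * \<phi> (real M) + 6 * \<phi> (real M + 1)
      - 4 * \<phi> (real M + 2) + \<phi> (real M + 3)"
  proof -
    have "\<bar>real_of_int (int M + 1 - 2)\<bar> = \<bar>real M - 1\<bar>" "\<bar>real_of_int (int M + 1 - 1)\<bar> = real M"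
      "\<bar>real_of_int (int M + 1)\<bar> = real M + 1" "\<bar>real_of_int (int M + 1 + 1)\<bar> = real M + 2"
      "\<bar>real_of_int (int M + 1 + 2)\<bar> = real M + 3"
      by simp_all
    then show ?thesis unfolding entry_eq by presburger
  qed
  also have "(\<Sum>p\<in>{- int M..int M}. entry \<bar>p\<bar>) =
      2 * (\<phi> (real M + 2) - 3 * \<phi> (real M + 1) + 3 * \<phi> (real M) - \<phi> \<bar>real M - 1\<bar>)"
    by (rule Suc.IH)
  moreover have ring: "2 * (x - 3 * y + 3 * z - w) + 2 * (w - 4 * z + 6 * y - 4 * x + v) =
      2 * (v - 3 * x + 3 * y - z)" for v w x y z :: real
    by simp
  ultimately have "(\<Sum>p\<in>{- int (Suc M)..int (Suc M)}. entry \<bar>p\<bar>) =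
      2 * (\<phi> (real M + 3) - 3 * \<phi> (real M + 2) + 3 * \<phi> (real M + 1) - \<phi> (real M))"
    by (simp only:)
  moreover have "real (Suc M) = real M + 1" "real M + 1 + 2 = real M + 3"
    "real M + 1 + 1 = real M + 2" "\<bar>real M + 1 - 1\<bar> = real M" by simp_all
  ultimately show ?case by (simp only:)
qed

text \<open>
  A matrix row runs over a set of distances that contains \<open>0\<close>. Completing it to a symmetric range
  adds only nonpositive off-diagonal entries, and the completed sum is a third difference.
\<close>

lemma row_sum_nonneg:
  assumes "j < m"
  shows "0 \<le> (\<Sum>k<m. entry \<bar>int j - int k\<bar>)"
proof -
  let ?P = "(\<lambda>k. int j - int k) ` {..<m}"
  have "0 \<le> (\<Sum>p\<in>{- int m..int m}. entry \<bar>p\<bar>)"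
    unfolding entry_sum using third_difference_nonneg[of "real m"] assms by simp
  also have "\<dots> \<le> (\<Sum>p\<in>?P. entry \<bar>p\<bar>)"
  proof -
    have "(\<Sum>p\<in>{- int m..int m} - ?P. entry \<bar>p\<bar>) \<le> 0"
    proof (rule sum_nonpos)
      fix p assume "p \<in> {- int m..int m} - ?P"
      moreover have "0 \<in> ?P" using assms by (auto intro!: image_eqI[of _ _ j])
      ultimately have "p \<noteq> 0" by auto
      then show "entry \<bar>p\<bar> \<le> 0" by (intro entry_nonpos) simp
    qed
    moreover have "?P \<subseteq> {- int m..int m}" using assms by auto
    ultimately show ?thesis
      using sum.subset_diff[of ?P "{- int m..int m}" "\<lambda>p. entry \<bar>p\<bar>"] by simp
  qed
  also have "\<dots> = (\<Sum>k<m. entry \<bar>int j - int k\<bar>)"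
    by (subst sum.reindex) (auto simp: inj_on_def)
  finally show ?thesis .
qed

end

section \<open>The sign of the threshold function\<close>

text \<open>
  This is \<open>3 ^ 9 < 2 ^ 16\<close>. It gives both the positive slope of \<open>s0_eq\<close> at its root \<open>1/2\<close> and
  the sign of the matrix entry at distance \<open>1\<close> for \<open>s = 1/2\<close>.
\<close>

lemma nine_ln_three_less: "9 * ln 3 < 16 * ln (2::real)"
proof -
  have "9 * ln (3::real) = ln (3 ^ 9)" by (subst ln_realpow) auto
  also have "\<dots> < ln (2 ^ 16)" by (subst ln_less_cancel_iff) auto
  also have "\<dots> = 16 * ln 2" by (subst ln_realpow) auto
  finally show ?thesis .
qed

text \<open>
  Besides \<open>s0\<close>, the function \<open>s0_eq\<close> has the root \<open>1/2\<close>, and it is increasing there.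
\<close>

lemma s0_eq_pos_right_neg_left_of_half:
  obtains d where "0 < d" "d < 1/2"
    "\<And>t. 0 < t \<Longrightarrow> t < d \<Longrightarrow> s0_eq (1/2 - t) < 0 \<and> 0 < s0_eq (1/2 + t)"
proof -
  have pos: "0 < 2 * ln 2 * 2 powr (5 - 2 * (1/2)) - 2 * ln 3 * (3::real) powr (3 - 2 * (1/2))"
    using nine_ln_three_less by simp
  obtain d1 where d1: "0 < d1" "\<And>t. 0 < t \<Longrightarrow> t < d1 \<Longrightarrow> s0_eq (1/2 - t) < s0_eq (1/2)"
    using DERIV_pos_inc_left[OF s0_eq_has_derivative pos] by auto
  obtain d2 where d2: "0 < d2" "\<And>t. 0 < t \<Longrightarrow> t < d2 \<Longrightarrow> s0_eq (1/2) < s0_eq (1/2 + t)"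
    using DERIV_pos_inc_right[OF s0_eq_has_derivative pos] by auto
  show ?thesis
    using d1 d2 by (intro that[of "min (min d1 d2) (1/4)"]) (auto simp: s0_eq_half)
qed

lemma s0_eq_continuous: "continuous_on A s0_eq"
  by (rule DERIV_continuous_on, rule has_field_derivative_at_within, rule s0_eq_has_derivative)

lemma s0_root: "0 < s0" "s0 < 1/2" "s0_eq s0 = 0"
  using theI'[OF s0_unique] by (auto simp: s0_def)

lemma s0_eqI: "0 < r \<Longrightarrow> r < 1/2 \<Longrightarrow> s0_eq r = 0 \<Longrightarrow> r = s0"
  unfolding s0_def by (rule the1_equality[OF s0_unique, symmetric]) simp

text \<open>
  A nonnegative value at \<open>s\<close> would, by the negative values just below \<open>1/2\<close>, produce a second root
  in \<open>(0, 1/2)\<close>.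
\<close>

lemma s0_eq_neg:
  assumes "s0 < s" "s < 1/2" shows "s0_eq s < 0"
proof (rule ccontr)
  assume "\<not> s0_eq s < 0"
  obtain d where d: "0 < d" "\<And>t. 0 < t \<Longrightarrow> t < d \<Longrightarrow> s0_eq (1/2 - t) < 0"
    using s0_eq_pos_right_neg_left_of_half by metis
  define t where "t = min d (1/2 - s) / 2"
  have t: "0 < t" "t < d" "t < 1/2 - s" using d assms by (auto simp: t_def)
  have "\<exists>r\<ge>s. r \<le> 1/2 - t \<and> s0_eq r = 0"
    by (rule IVT2') (use d(2)[of t] t \<open>\<not> s0_eq s < 0\<close> s0_eq_continuous in auto)
  then obtain r where "s \<le> r" "r \<le> 1/2 - t" "s0_eq r = 0" by blast
  then have "r = s0" using s0_eqI[of r] s0_root assms t by linarith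
  then show False using assms \<open>s \<le> r\<close> by simp
qed

text \<open>
  A nonpositive value at \<open>s\<close> would produce a third root \<open>r > 1/2\<close>. By Rolle's theorem there would
  then be a critical point on either side of \<open>1/2\<close>, but \<open>s0_eq\<close> has at most one.
\<close>

lemma s0_eq_pos:
  assumes "1/2 < s" "s \<le> 1" shows "0 < s0_eq s"
proof (rule ccontr)
  assume "\<not> 0 < s0_eq s"
  obtain d where d: "0 < d" "\<And>t. 0 < t \<Longrightarrow> t < d \<Longrightarrow> 0 < s0_eq (1/2 + t)"
    using s0_eq_pos_right_neg_left_of_half by metis
  define t where "t = min d (s - 1/2) / 2"
  have t: "0 < t" "t < d" "t < s - 1/2" using d assms by (auto simp: t_def)
  have "\<exists>r\<ge>1/2 + t. r \<le> s \<and> s0_eq r = 0"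
    by (rule IVT2') (use d(2)[of t] t \<open>\<not> 0 < s0_eq s\<close> s0_eq_continuous in auto)
  then obtain r where r: "1/2 + t \<le> r" "r \<le> s" "s0_eq r = 0" by blast
  have rolle: "\<exists>y::real. p < y \<and> y < q \<and> 2 * ln 2 * 2 powr (5 - 2 * y) = 2 * ln 3 * 3 powr (3 - 2 * y)"
    if "p < q" "s0_eq p = s0_eq q" for p q
    using MVT2[OF that(1), of s0_eq, OF s0_eq_has_derivative] that by simp
  obtain y where y: "s0 < y" "y < 1/2"
    "2 * ln 2 * 2 powr (5 - 2 * y) = 2 * ln 3 * 3 powr (3 - 2 * y)"
    using rolle[of s0 "1/2"] s0_root s0_eq_half by metis
  obtain z :: real where z: "1/2 < z"
    "2 * ln 2 * 2 powr (5 - 2 * z) = 2 * ln 3 * 3 powr (3 - 2 * z)"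
    using rolle[of "1/2" r] r t s0_eq_half by auto
  show False using s0_eq_critical_unique[of y z] y z by simp
qed

section \<open>The kernels of the fractional Laplacian\<close>

definition kernel_coefficient :: "real \<Rightarrow> real \<Rightarrow> real" where
  "kernel_coefficient s h = h powr (1 - 2 * s) / (2 * Gamma (4 - 2 * s) * cos (s * pi))"

lemma cos_pos_lower:
  assumes "0 < s" "s < 1/2" shows "0 < cos (s * pi)"
  using assms by (intro cos_gt_zero) (auto simp: field_simps)

lemma cos_neg_upper:
  assumes "1/2 < s" "s \<le> 1" shows "cos (s * pi) < 0"
proof -
  have "0 < cos ((1 - s) * pi)" using assms by (intro cos_gt_zero_pi) (auto simp: field_simps)
  moreover have "cos (s * pi) = - cos ((1 - s) * pi)"
    by (simp add: algebra_simps cos_diff)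
  ultimately show ?thesis by simp
qed

text \<open>
  The third derivative is a power with negative exponent, so only the sign of its coefficient
  matters. The coefficient is nonnegative because \<open>x - 2 = 1 - 2 s\<close> has the same sign as
  \<open>cos (s \<pi>)\<close>. The condition at distance \<open>1\<close> reads \<open>K * s0_eq s \<le> 0\<close>.
\<close>

lemma powr_kernel:
  assumes "0 < h" "s0 < s" "s \<le> 1" "s \<noteq> 1/2"
  defines "x \<equiv> 3 - 2 * s" and "K \<equiv> kernel_coefficient s h"
  shows "stencil_kernel (\<lambda>y. K * y powr x) (\<lambda>y. K * x * y powr (x - 1))
    (\<lambda>y. K * x * (x - 1) * y powr (x - 2)) (\<lambda>y. K * x * (x - 1) * (x - 2) * y powr (x - 3))"
proof -
  have x: "1 \<le> x" "x < 3" using assms s0_root by (auto simp: x_def)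
  have sign: "0 \<le> K * (x - 2) \<and> K * s0_eq s \<le> 0"
  proof (cases "s < 1/2")
    case True
    then have "0 \<le> K"
      using assms s0_root cos_pos_lower[of s] Gamma_real_pos[of "4 - 2 * s"]
      by (simp add: kernel_coefficient_def)
    then show ?thesis using s0_eq_neg[of s] True assms
      by (simp add: x_def mult_nonneg_nonpos)
  next
    case False
    then have "K \<le> 0"
      using assms cos_neg_upper[of s] Gamma_real_pos[of "4 - 2 * s"]
      by (auto simp: kernel_coefficient_def divide_nonneg_nonpos mult_nonneg_nonpos)
    then show ?thesis using s0_eq_pos[of s] False assms
      by (simp add: x_def mult_nonpos_nonpos mult_nonpos_nonneg)
  qed
  have coeff: "0 \<le> K * x * (x - 1) * (x - 2)"
  proof -
    have "0 \<le> (K * (x - 2)) * (x * (x - 1))"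
      by (rule mult_nonneg_nonneg[OF conjunct1[OF sign]]) (use x in simp)
    then show ?thesis by (simp add: mult_ac)
  qed
  show ?thesis
  proof
    show "continuous_on {0..} (\<lambda>y. K * y powr x)"
      using x by (intro continuous_on_mult continuous_on_powr' continuous_on_const continuous_on_id) auto
    have "K * s0_eq s = K * 3 powr x - 4 * (K * 2 powr x) + 7 * K"
    proof -
      have "(2::real) powr (5 - 2 * s) = 2 powr (2 + x)" by (simp add: x_def)
      then have "(2::real) powr (5 - 2 * s) = 4 * 2 powr x" by (simp add: powr_add)
      then show ?thesis unfolding s0_eq_def x_def[symmetric] by (simp add: distrib_left right_diff_distrib)
    qed
    then show "K * 3 powr x - 4 * (K * 2 powr x) + 7 * (K * 1 powr x) - 4 * (K * 0 powr x) \<le> 0"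
      using sign by simp
    show "K * x * (x - 1) * (x - 2) * z powr (x - 3) \<le> K * x * (x - 1) * (x - 2) * y powr (x - 3)"
      if "0 < y" "y \<le> z" for y z
      by (rule mult_left_mono[OF powr_mono2' coeff]) (use that x in auto)
    show "0 \<le> K * x * (x - 1) * (x - 2) * y powr (x - 3)" for y
      by (rule mult_nonneg_nonneg[OF coeff]) simp
    have deriv: "((\<lambda>y. C * y powr r) has_real_derivative C * r * y powr q) (at y)"
      if "0 < y" "q = r - 1" for C r q y :: real
      using DERIV_cmult[OF has_real_derivative_powr[OF that(1), of r], of C] that(2)
      by (simp add: mult.assoc)
    show "((\<lambda>y. K * y powr x) has_real_derivative K * x * y powr (x - 1)) (at y)"
      "((\<lambda>y. K * x * y powr (x - 1)) has_real_derivative K * x * (x - 1) * y powr (x - 2)) (at y)"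
      "((\<lambda>y. K * x * (x - 1) * y powr (x - 2)) has_real_derivative
          K * x * (x - 1) * (x - 2) * y powr (x - 3)) (at y)"
      if "0 < y" for y
      by (rule deriv[OF that]; simp)+
  qed
qed

lemma log_kernel:
  "stencil_kernel (\<lambda>y. y\<^sup>2 * ln y / (2 * pi)) (\<lambda>y. (2 * y * ln y + y) / (2 * pi))
    (\<lambda>y. (2 * ln y + 3) / (2 * pi)) (\<lambda>y. 1 / (pi * y))"
proof
  show "continuous_on {0..} (\<lambda>y::real. y\<^sup>2 * ln y / (2 * pi))"
  proof (rule continuous_on_divide)
    have "continuous (at y within {0..}) (\<lambda>y::real. y\<^sup>2 * ln y)" if "0 \<le> y" for y
    proof (cases "y = 0")
      case True
      have "((\<lambda>y::real. y\<^sup>2 * ln y) \<longlongrightarrow> 0) (at_right 0)" by real_asymp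
      then show ?thesis using True
        by (simp add: continuous_within at_within_Ici_at_right)
    next
      case False
      then show ?thesis using that by (intro continuous_intros) auto
    qed
    then show "continuous_on {0..} (\<lambda>y::real. y\<^sup>2 * ln y)"
      by (simp add: continuous_on_eq_continuous_within)
  qed auto
  show "3\<^sup>2 * ln 3 / (2 * pi) - 4 * (2\<^sup>2 * ln 2 / (2 * pi)) + 7 * (1\<^sup>2 * ln 1 / (2 * pi))
      - 4 * (0\<^sup>2 * ln 0 / (2 * pi)) \<le> 0"
    using nine_ln_three_less by (simp add: field_simps)
  fix y :: real assume y: "0 < y"
  show "((\<lambda>y. y\<^sup>2 * ln y / (2 * pi)) has_real_derivative (2 * y * ln y + y) / (2 * pi)) (at y)"
    using y by (auto intro!: derivative_eq_intros simp: field_simps power2_eq_square)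
  show "((\<lambda>y. (2 * y * ln y + y) / (2 * pi)) has_real_derivative (2 * ln y + 3) / (2 * pi)) (at y)"
    using y by (auto intro!: derivative_eq_intros simp: field_simps)
  show "((\<lambda>y. (2 * ln y + 3) / (2 * pi)) has_real_derivative 1 / (pi * y)) (at y)"
    using y by (auto intro!: derivative_eq_intros simp: field_simps)
  show "0 \<le> 1 / (pi * y)" using y by simp
  show "1 / (pi * z) \<le> 1 / (pi * y)" if "y \<le> z" for z
    using y that by (simp add: frac_le)
qed

section \<open>The diagonal entry\<close>

text \<open>
  The chord of the concave function \<open>sin (\<pi> t / 2)\<close> over the interval from \<open>u\<close> to \<open>w\<close>.
\<close>

lemma sin_ge_chord:
  assumes "0 \<le> u" "u \<le> t" "t \<le> w" "w \<le> 1" "u < w"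
  shows "sin (pi * u / 2) + (t - u) / (w - u) * (sin (pi * w / 2) - sin (pi * u / 2)) \<le> sin (pi * t / 2)"
proof -
  have conc: "concave_on {0..pi} sin"
    by (rule f''_le0_imp_concave[where f' = cos and f'' = "\<lambda>x. - sin x"])
       (auto intro!: derivative_eq_intros sin_ge_zero)
  define \<theta> where "\<theta> = (t - u) / (w - u)"
  have l: "0 \<le> \<theta>" "\<theta> \<le> 1" using assms by (auto simp: \<theta>_def field_simps)
  have "u + \<theta> * (w - u) = t" using assms by (simp add: \<theta>_def)
  then have t: "pi * t / 2 = (1 - \<theta>) *\<^sub>R (pi * u / 2) + \<theta> *\<^sub>R (pi * w / 2)"
    unfolding \<open>u + \<theta> * (w - u) = t\<close>[symmetric] by (simp add: field_simps)
  have "pi * v / 2 \<le> pi" "0 \<le> pi * v / 2" if "0 \<le> v" "v \<le> 1" for v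
    using that mult_left_mono[of v 2 pi] by auto
  then have "(1 - \<theta>) * sin (pi * u / 2) + \<theta> * sin (pi * w / 2) \<le> sin (pi * t / 2)"
    unfolding t using assms by (intro concave_onD[OF conc] l) auto
  then show ?thesis unfolding \<theta>_def[symmetric] by (simp add: left_diff_distrib right_diff_distrib)
qed

lemma two_powr_tangent: "2 powr c * (1 + (u - c) * ln 2) \<le> (2::real) powr u"
proof -
  have "2 powr c * (1 + (u - c) * ln 2) \<le> 2 powr c * 2 powr (u - c)"
    using exp_ge_add_one_self[of "(u - c) * ln 2"] by (intro mult_left_mono) (auto simp: powr_def)
  then show ?thesis by (simp flip: powr_add)
qed

text \<open>
  Both sides vanish at \<open>0\<close> and equal \<open>1\<close> at \<open>1\<close>, and a single line does not separate them. On
  each half of the interval the chord of the sine lies above the tangent of the left side at the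
  outer end point: the slopes are \<open>sqrt 2\<close> and \<open>2 ln 2\<close> on the first half, \<open>2 - sqrt 2\<close> and
  \<open>ln 2\<close> on the second.
\<close>

lemma two_powr_neg_sin_bound:
  assumes "0 \<le> u" "u \<le> 1"
  shows "2 * (1 - 2 powr (- u)) \<le> sin (pi * u / 2)"
proof (cases "u \<le> 1/2")
  case True
  have "7/10 \<le> sqrt (2::real) / 2"
    using real_le_rsqrt[of "7/5" 2] by (simp add: power2_eq_square)
  then have "u * (2 * ln 2) \<le> u * (2 * (sqrt 2 / 2))"
    using assms ln2_le_25_over_36 by (intro mult_left_mono) auto
  also have "\<dots> \<le> sin (pi * u / 2)"
    using sin_ge_chord[of 0 u "1/2"] assms True by (simp add: sin_45 mult_ac)
  finally show ?thesis using two_powr_tangent[of 0 "- u"] by (simp add: algebra_simps)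
next
  case False
  have "7/10 \<le> sqrt (2::real) / 2"
    using real_le_rsqrt[of "7/5" 2] by (simp add: power2_eq_square)
  then have "(1 - u) * (2 * (1 - sqrt 2 / 2)) \<le> (1 - u) * ln 2"
    using assms ln2_ge_two_thirds by (intro mult_left_mono) auto
  moreover have "1 - (1 - u) * (2 * (1 - sqrt 2 / 2)) \<le> sin (pi * u / 2)"
  proof -
    have ring: "c + (u * 2 - 1) * (1 - c) = 1 - (1 - u) * (2 * (1 - c))" for c :: real
      by (simp add: algebra_simps)
    have "sqrt 2 / 2 + (u * 2 - 1) * (1 - sqrt 2 / 2) \<le> sin (pi * u / 2)"
      using sin_ge_chord[of "1/2" u 1] assms False by (simp add: sin_45)
    then show ?thesis unfolding ring .
  qed
  moreover have "(1 + (1 - u) * ln 2) / 2 \<le> 2 powr (- u)"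
    using two_powr_tangent[of "-1" "- u"] by (simp add: powr_minus_divide)
  ultimately show ?thesis by argo
qed

lemma two_powr_sin_bound:
  assumes "0 \<le> v" "v \<le> 1"
  shows "2 powr v - 1 \<le> sin (pi * v / 2)"
proof -
  have "2 powr v \<le> 1 + v"
  proof -
    have "exp ((1 - v) *\<^sub>R 0 + v *\<^sub>R ln 2) \<le> (1 - v) * exp 0 + v * exp (ln (2::real))"
      using assms by (intro convex_onD[OF exp_convex]) auto
    then show ?thesis by (simp add: powr_def)
  qed
  moreover have "v \<le> sin (pi * v / 2)" using sin_ge_chord[of 0 v 1] assms by simp
  ultimately show ?thesis by simp
qed

lemma Gamma_ge_one: "2 \<le> x \<Longrightarrow> 1 \<le> Gamma (x::real)"
  using Gamma_real_strict_mono[of 2 x] by (cases "x = 2") (auto simp: Gamma_numeral)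

lemma Gamma_ge_two: "3 \<le> x \<Longrightarrow> 2 \<le> Gamma (x::real)"
  using Gamma_real_strict_mono[of 3 x] by (cases "x = 3") (auto simp: Gamma_numeral)

text \<open>
  The left side is the diagonal entry for \<open>s \<noteq> 1/2\<close>. Numerator and \<open>cos (s \<pi>)\<close> change sign
  together at \<open>s = 1/2\<close>. For \<open>s < 1/2\<close> the bound \<open>Gamma (4 - 2 s) \<ge> 2\<close> is available; for
  \<open>s > 1/2\<close> only \<open>Gamma (4 - 2 s) \<ge> 1\<close> is, and this is sharp at \<open>s = 1\<close>.
\<close>

lemma kernel_coefficient_bound:
  assumes "0 < h" "0 < s" "s \<le> 1" "s \<noteq> 1/2"
  shows "kernel_coefficient s h * (2 * 2 powr (3 - 2 * s) - 8) \<le> 2 * h powr (1 - 2 * s)"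
proof -
  have "(2 * 2 powr (3 - 2 * s) - 8) / (2 * Gamma (4 - 2 * s) * cos (s * pi)) \<le> 2"
  proof (cases "s < 1/2")
    case True
    define v where "v = 1 - 2 * s"
    have v: "0 < v" "v < 1" using True assms by (auto simp: v_def)
    have "(2::real) powr (3 - 2 * s) = 2 powr (2 + v)" by (simp add: v_def)
    then have pw: "(2::real) powr (3 - 2 * s) = 4 * 2 powr v" by (simp add: powr_add)
    have "cos (s * pi) = cos (pi / 2 - pi * v / 2)" by (simp add: v_def field_simps)
    then have co: "cos (s * pi) = sin (pi * v / 2)" by (simp add: cos_diff)
    have "0 < sin (pi * v / 2)" using co cos_pos_lower[of s] assms True by simp
    have "2 * 2 powr (3 - 2 * s) - 8 \<le> 2 * (2 * 2 * sin (pi * v / 2))"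
      using two_powr_sin_bound[of v] v pw by simp
    also have "\<dots> \<le> 2 * (2 * Gamma (4 - 2 * s) * sin (pi * v / 2))"
      using Gamma_ge_two[of "4 - 2 * s"] True \<open>0 < sin (pi * v / 2)\<close> by (intro mult_left_mono mult_right_mono) auto
    finally show ?thesis
      using \<open>0 < sin (pi * v / 2)\<close> Gamma_real_pos[of "4 - 2 * s"] True
      by (simp add: co divide_le_eq)
  next
    case False
    define u where "u = 2 * s - 1"
    have u: "0 < u" "u \<le> 1" using False assms by (auto simp: u_def)
    have "(2::real) powr (3 - 2 * s) = 2 powr (2 + (- u))" by (simp add: u_def)
    then have pw: "(2::real) powr (3 - 2 * s) = 4 * 2 powr (- u)" unfolding powr_add by simp
    have "cos (s * pi) = cos (pi / 2 + pi * u / 2)" by (simp add: u_def field_simps)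
    then have co: "cos (s * pi) = - sin (pi * u / 2)" by (simp add: cos_add)
    have "0 < sin (pi * u / 2)" using co cos_neg_upper[of s] assms False by simp
    have "8 - 2 * 2 powr (3 - 2 * s) \<le> 2 * (2 * 1 * sin (pi * u / 2))"
      using two_powr_neg_sin_bound[of u] u pw by simp
    also have "\<dots> \<le> 2 * (2 * Gamma (4 - 2 * s) * sin (pi * u / 2))"
      using Gamma_ge_one[of "4 - 2 * s"] assms \<open>0 < sin (pi * u / 2)\<close> by (intro mult_left_mono mult_right_mono) auto
    finally have "(8 - 2 * 2 powr (3 - 2 * s)) / (2 * Gamma (4 - 2 * s) * sin (pi * u / 2)) \<le> 2"
      using \<open>0 < sin (pi * u / 2)\<close> Gamma_real_pos[of "4 - 2 * s"] assms
      by (simp add: divide_le_eq)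
    moreover have "(2 * 2 powr (3 - 2 * s) - 8) / (2 * Gamma (4 - 2 * s) * cos (s * pi))
        = (8 - 2 * 2 powr (3 - 2 * s)) / (2 * Gamma (4 - 2 * s) * sin (pi * u / 2))"
      unfolding co by (simp add: minus_divide_left flip: minus_divide_right)
    ultimately show ?thesis by simp
  qed
  then have "h powr (1 - 2 * s) * ((2 * 2 powr (3 - 2 * s) - 8) / (2 * Gamma (4 - 2 * s) * cos (s * pi)))
      \<le> h powr (1 - 2 * s) * 2"
    by (intro mult_left_mono) auto
  then show ?thesis by (simp add: kernel_coefficient_def mult_ac)
qed

lemma stiffness_entry_properties:
  assumes "0 < h" "s0 < s" "s \<le> 1"
  shows stiffness_offdiagonal_nonpos: "1 \<le> p \<Longrightarrow> stiffness_entry s h p \<le> 0"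
    and stiffness_row_sum_nonneg: "j < m \<Longrightarrow> 0 \<le> (\<Sum>k<m. stiffness_entry s h \<bar>int j - int k\<bar>)"
    and stiffness_diagonal_le: "stiffness_entry s h 0 \<le> 2 * h powr (1 - 2 * s)"
proof -
  have "(1 \<le> p \<longrightarrow> stiffness_entry s h p \<le> 0) \<and>
    (j < m \<longrightarrow> 0 \<le> (\<Sum>k<m. stiffness_entry s h \<bar>int j - int k\<bar>)) \<and>
    stiffness_entry s h 0 \<le> 2 * h powr (1 - 2 * s)"
  proof (cases "s = 1/2")
    case True
    interpret stencil_kernel "\<lambda>y. y\<^sup>2 * ln y / (2 * pi)" "\<lambda>y. (2 * y * ln y + y) / (2 * pi)"
      "\<lambda>y. (2 * ln y + 3) / (2 * pi)" "\<lambda>y. 1 / (pi * y)"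
      by (rule log_kernel)
    have eq: "stiffness_entry s h p = entry p" for p
      by (simp add: stiffness_entry_def True entry_def sum_divide_distrib mult.assoc)
    have "entry 0 = 4 * ln 2 / pi" unfolding entry_eq by (simp add: field_simps)
    also have "\<dots> \<le> 2" using ln_2_less_1 pi_gt3 by (simp add: divide_le_eq)
    finally have "entry 0 \<le> 2 * h powr (1 - 2 * s)" unfolding True using \<open>0 < h\<close> by simp
    then show ?thesis using entry_nonpos row_sum_nonneg by (simp add: eq)
  next
    case False
    define x where "x = 3 - 2 * s"
    define K where "K = kernel_coefficient s h"
    interpret stencil_kernel "\<lambda>y. K * y powr x" "\<lambda>y. K * x * y powr (x - 1)"
      "\<lambda>y. K * x * (x - 1) * y powr (x - 2)" "\<lambda>y. K * x * (x - 1) * (x - 2) * y powr (x - 3)"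
      unfolding x_def K_def using False assms by (intro powr_kernel)
    have eq: "stiffness_entry s h p = entry p" for p
    proof -
      have "entry p = K * (\<Sum>i\<in>{-2..2}. stencil i * \<bar>real_of_int (p + i)\<bar> powr x)"
        unfolding entry_def by (simp add: sum_distrib_left mult.left_commute)
      moreover have "stiffness_entry s h p = K * (\<Sum>i\<in>{-2..2}. stencil i * \<bar>real_of_int (p + i)\<bar> powr x)"
        unfolding stiffness_entry_def K_def x_def kernel_coefficient_def using False by simp
      ultimately show ?thesis by simp
    qed
    have "entry 0 = K * (2 * 2 powr x - 8)" by (simp add: entry_eq algebra_simps)
    also have "\<dots> \<le> 2 * h powr (1 - 2 * s)"
      unfolding x_def K_def using assms s0_root False by (intro kernel_coefficient_bound) auto
    finally show ?thesis
      using entry_nonpos row_sum_nonneg by (simp add: eq)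
  qed
  then show "1 \<le> p \<Longrightarrow> stiffness_entry s h p \<le> 0"
    "j < m \<Longrightarrow> 0 \<le> (\<Sum>k<m. stiffness_entry s h \<bar>int j - int k\<bar>)"
    "stiffness_entry s h 0 \<le> 2 * h powr (1 - 2 * s)" by auto
qed

section \<open>The discrete maximum principle\<close>

lemma f_reflect: "f (1 - u) = - f u"
  by (simp add: f_def field_simps)

lemma f_neg: "u < 0 \<Longrightarrow> f u \<le> 0"
  by (simp add: f_def mult_nonneg_nonpos mult_nonpos_nonpos mult_nonneg_nonpos2)

lemma f_le: "0 \<le> u \<Longrightarrow> u \<le> 1 \<Longrightarrow> f u \<le> u / 2"
proof -
  assume u: "0 \<le> u" "u \<le> 1"
  have "(u - 1) * (2 * u - 1) = 1 - u * (3 - 2 * u)" by (simp add: algebra_simps)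
  also have "\<dots> \<le> 1" using u by simp
  finally have "u * ((u - 1) * (2 * u - 1)) \<le> u * 1" using u by (intro mult_left_mono) auto
  moreover have "f u = u * ((u - 1) * (2 * u - 1)) / 2" by (simp add: f_def mult.assoc)
  ultimately show ?thesis by linarith
qed

text \<open>
  At a negative minimum of \<open>V\<close> the diffusion and the reaction of \<open>W\<close> can each make up for at most
  half of the term \<open>- W j\<close>, which leaves a residual of at most \<open>V j\<close>.
\<close>

lemma supersolution_nonneg:
  fixes A :: "'i \<Rightarrow> 'i \<Rightarrow> real" and V W :: "'i \<Rightarrow> real"
  assumes fin: "finite J"
    and off: "\<And>j k. j \<in> J \<Longrightarrow> k \<in> J \<Longrightarrow> j \<noteq> k \<Longrightarrow> A j k \<le> 0"
    and row: "\<And>j. j \<in> J \<Longrightarrow> 0 \<le> (\<Sum>k\<in>J. A j k)"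
    and diag: "\<And>j. j \<in> J \<Longrightarrow> \<kappa> * A j j \<le> 1/2"
    and "0 \<le> \<kappa>" "0 \<le> \<tau>" "\<tau> \<le> 2"
    and W: "\<And>j. j \<in> J \<Longrightarrow> 0 \<le> W j \<and> W j \<le> 1"
    and super: "\<And>j. j \<in> J \<Longrightarrow>
      0 \<le> V j - W j + \<kappa> * (\<Sum>k\<in>J. A j k * (V k + W k)) + \<tau> / 2 * (f (V j) + f (W j))"
    and "i \<in> J"
  shows "0 \<le> V i"
proof (rule ccontr)
  assume "\<not> 0 \<le> V i"
  obtain j where j: "j \<in> J" and min: "\<And>k. k \<in> J \<Longrightarrow> V j \<le> V k"
    using ex_is_arg_min_if_finite[of J V] fin \<open>i \<in> J\<close>
    by (auto simp: is_arg_min_linorder)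
  have neg: "V j < 0" using min[OF \<open>i \<in> J\<close>] \<open>\<not> 0 \<le> V i\<close> by simp
  have "(\<Sum>k\<in>J. A j k * V k) \<le> (\<Sum>k\<in>J. A j k * V j)"
  proof (rule sum_mono)
    fix k assume "k \<in> J"
    then show "A j k * V k \<le> A j k * V j"
      using off[OF j] min by (cases "k = j") (auto intro!: mult_left_mono_neg)
  qed
  also have "\<dots> = (\<Sum>k\<in>J. A j k) * V j" by (simp add: sum_distrib_right)
  also have "\<dots> \<le> 0" using row[OF j] neg by (intro mult_nonneg_nonpos) auto
  finally have AV: "(\<Sum>k\<in>J. A j k * V k) \<le> 0" .
  have "(\<Sum>k\<in>J. A j k * W k) = A j j * W j + (\<Sum>k\<in>J - {j}. A j k * W k)"
    using fin j by (rule sum.remove)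
  also have "(\<Sum>k\<in>J - {j}. A j k * W k) \<le> 0"
    using off[OF j] W by (intro sum_nonpos mult_nonpos_nonneg) auto
  finally have "(\<Sum>k\<in>J. A j k * (V k + W k)) \<le> A j j * W j"
    using AV by (simp add: distrib_left sum.distrib)
  then have "\<kappa> * (\<Sum>k\<in>J. A j k * (V k + W k)) \<le> \<kappa> * (A j j * W j)"
    using \<open>0 \<le> \<kappa>\<close> by (rule mult_left_mono)
  also have "\<dots> = (\<kappa> * A j j) * W j" by simp
  also have "\<dots> \<le> 1/2 * W j" using diag[OF j] W[OF j] by (intro mult_right_mono) auto
  finally have diffusion: "\<kappa> * (\<Sum>k\<in>J. A j k * (V k + W k)) \<le> W j / 2" by simp
  have "\<tau> / 2 * (f (V j) + f (W j)) \<le> \<tau> / 2 * (W j / 2)"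
    using f_neg[OF neg] f_le[of "W j"] W[OF j] \<open>0 \<le> \<tau>\<close> by (intro mult_left_mono) auto
  also have "\<dots> \<le> 1 * (W j / 2)" using W[OF j] \<open>\<tau> \<le> 2\<close> by (intro mult_right_mono) auto
  finally show False using super[OF j] diffusion neg by simp
qed

text \<open>
  Replacing \<open>V\<close> and \<open>W\<close> by \<open>1 - V\<close> and \<open>1 - W\<close> changes the sign of the residual and adds
  \<open>2 * \<kappa>\<close> times the row sum, so \<open>1 - V\<close> is a supersolution as well.
\<close>

lemma crank_nicolson_step_bounds:
  fixes A :: "'i \<Rightarrow> 'i \<Rightarrow> real" and V W :: "'i \<Rightarrow> real"
  assumes fin: "finite J"
    and off: "\<And>j k. j \<in> J \<Longrightarrow> k \<in> J \<Longrightarrow> j \<noteq> k \<Longrightarrow> A j k \<le> 0"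
    and row: "\<And>j. j \<in> J \<Longrightarrow> 0 \<le> (\<Sum>k\<in>J. A j k)"
    and diag: "\<And>j. j \<in> J \<Longrightarrow> \<kappa> * A j j \<le> 1/2"
    and \<kappa>: "0 \<le> \<kappa>" and \<tau>: "0 \<le> \<tau>" "\<tau> \<le> 2"
    and W: "\<And>j. j \<in> J \<Longrightarrow> 0 \<le> W j \<and> W j \<le> 1"
    and eq: "\<And>j. j \<in> J \<Longrightarrow>
      V j - W j + \<kappa> * (\<Sum>k\<in>J. A j k * (V k + W k)) + \<tau> / 2 * (f (V j) + f (W j)) = 0"
    and i: "i \<in> J"
  shows "0 \<le> V i \<and> V i \<le> 1"
proof
  show "0 \<le> V i"
    by (rule supersolution_nonneg[OF fin off row diag \<kappa> \<tau> W _ i]) (use eq in auto)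
  have super: "0 \<le> (1 - V j) - (1 - W j) + \<kappa> * (\<Sum>k\<in>J. A j k * ((1 - V k) + (1 - W k)))
      + \<tau> / 2 * (f (1 - V j) + f (1 - W j))" if j: "j \<in> J" for j
  proof -
    have "(\<Sum>k\<in>J. A j k * ((1 - V k) + (1 - W k)))
        = 2 * (\<Sum>k\<in>J. A j k) - (\<Sum>k\<in>J. A j k * (V k + W k))"
      by (simp add: sum_distrib_left sum_subtractf[symmetric] algebra_simps)
    then have "\<kappa> * (\<Sum>k\<in>J. A j k * ((1 - V k) + (1 - W k)))
        = 2 * (\<kappa> * (\<Sum>k\<in>J. A j k)) - \<kappa> * (\<Sum>k\<in>J. A j k * (V k + W k))"
      by (simp only: right_diff_distrib mult.left_commute)
    moreover have "0 \<le> \<kappa> * (\<Sum>k\<in>J. A j k)" using row[OF j] \<kappa> by simp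
    moreover have "\<tau> / 2 * (f (1 - V j) + f (1 - W j)) = - (\<tau> / 2 * (f (V j) + f (W j)))"
      by (simp add: f_reflect algebra_simps)
    ultimately show ?thesis using eq[OF j] by linarith
  qed
  have "0 \<le> 1 - V i"
    by (rule supersolution_nonneg[OF fin off row diag \<kappa> \<tau> _ super i]) (use W in auto)
  then show "V i \<le> 1" by simp
qed

text \<open>
  The second bound on \<open>\<tau>\<close> enters only through \<open>\<kappa> * A j j \<le> 1/2\<close>, where the powers of \<open>h\<close>
  cancel against the diagonal bound.
\<close>

lemma stiffness_step_bounds:
  fixes V W :: "real vec"
  assumes "0 < h" "s0 < s" "s \<le> 1"
    and dim: "V \<in> carrier_vec (N - 1)" "W \<in> carrier_vec (N - 1)"
    and scheme: "(1 / \<tau>) \<cdot>\<^sub>v (V - W)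
        + (\<epsilon>\<^sup>2 / (2 * h)) \<cdot>\<^sub>v (stiffness_matrix s h N *\<^sub>v (V + W))
        + (1 / 2) \<cdot>\<^sub>v (map_vec f V + map_vec f W) = 0\<^sub>v (N - 1)"
    and "\<epsilon> \<noteq> 0" and tau: "0 < \<tau>" "\<tau> \<le> 2" "\<tau> \<le> h powr (2 * s) / (2 * \<epsilon>\<^sup>2)"
    and W: "\<And>j. j < N - 1 \<Longrightarrow> 0 \<le> W $ j \<and> W $ j \<le> 1"
    and i: "i < N - 1"
  shows "0 \<le> V $ i \<and> V $ i \<le> 1"
proof (rule crank_nicolson_step_bounds[where J = "{..<N - 1}" and V = "\<lambda>j. V $ j" and W = "\<lambda>j. W $ j"
      and A = "\<lambda>j k. stiffness_entry s h \<bar>int j - int k\<bar>" and \<kappa> = "\<tau> * \<epsilon>\<^sup>2 / (2 * h)" and \<tau> = \<tau>])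
  show "\<tau> * \<epsilon>\<^sup>2 / (2 * h) * stiffness_entry s h \<bar>int j - int j\<bar> \<le> 1/2" for j
  proof -
    have "\<tau> * \<epsilon>\<^sup>2 / (2 * h) * stiffness_entry s h \<bar>int j - int j\<bar>
        \<le> \<tau> * \<epsilon>\<^sup>2 / (2 * h) * (2 * h powr (1 - 2 * s))"
      using stiffness_diagonal_le[OF assms(1-3)] tau \<open>0 < h\<close> by (intro mult_left_mono) auto
    also have "\<dots> = \<tau> * \<epsilon>\<^sup>2 * h powr (- (2 * s))"
      using \<open>0 < h\<close> by (simp add: powr_diff powr_minus_divide)
    also have "\<dots> \<le> (h powr (2 * s) / 2) * h powr (- (2 * s))"
      using tau(3) \<open>\<epsilon> \<noteq> 0\<close> by (intro mult_right_mono) (auto simp: field_simps)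
    also have "\<dots> = 1/2" using \<open>0 < h\<close> by (simp add: powr_minus field_simps)
    finally show ?thesis .
  qed
  show "V $ j - W $ j + \<tau> * \<epsilon>\<^sup>2 / (2 * h) *
      (\<Sum>k\<in>{..<N - 1}. stiffness_entry s h \<bar>int j - int k\<bar> * (V $ k + W $ k))
      + \<tau> / 2 * (f (V $ j) + f (W $ j)) = 0" if "j \<in> {..<N - 1}" for j
  proof -
    have j: "j < N - 1" using that by simp
    have Sj: "(stiffness_matrix s h N *\<^sub>v (V + W)) $ j =
        (\<Sum>k<N - 1. stiffness_entry s h \<bar>int j - int k\<bar> * (V $ k + W $ k))"
      using j dim by (auto simp: stiffness_matrix_def scalar_prod_def atLeast0LessThan intro!: sum.cong)
    have "((1 / \<tau>) \<cdot>\<^sub>v (V - W)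
        + (\<epsilon>\<^sup>2 / (2 * h)) \<cdot>\<^sub>v (stiffness_matrix s h N *\<^sub>v (V + W))
        + (1 / 2) \<cdot>\<^sub>v (map_vec f V + map_vec f W)) $ j = 0"
      unfolding scheme using j by simp
    moreover have "dim_row (stiffness_matrix s h N) = N - 1" by (simp add: stiffness_matrix_def)
    ultimately have "(1 / \<tau>) * (V $ j - W $ j) + \<epsilon>\<^sup>2 / (2 * h) *
        (\<Sum>k<N - 1. stiffness_entry s h \<bar>int j - int k\<bar> * (V $ k + W $ k))
        + 1 / 2 * (f (V $ j) + f (W $ j)) = 0"
      using j dim by (simp add: Sj del: index_mult_mat_vec)
    then have "\<tau> * ((1 / \<tau>) * (V $ j - W $ j) + \<epsilon>\<^sup>2 / (2 * h) *
        (\<Sum>k<N - 1. stiffness_entry s h \<bar>int j - int k\<bar> * (V $ k + W $ k))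
        + 1 / 2 * (f (V $ j) + f (W $ j))) = 0" by simp
    then show ?thesis using tau by (simp add: distrib_left)
  qed
  show "stiffness_entry s h \<bar>int j - int k\<bar> \<le> 0" if "j \<noteq> k" for j k
    using that by (intro stiffness_offdiagonal_nonpos[OF assms(1-3)]) auto
qed (use assms stiffness_row_sum_nonneg in auto)

theorem theorem4:
  fixes a b \<epsilon> s \<tau> h :: real
    and N :: nat
    and u0 :: "real \<Rightarrow> real"
    and U :: "nat \<Rightarrow> real vec"
  assumes "a < b" and "N \<ge> 2" and "\<epsilon> > 0"
    and h: "h = mesh_size a b N"
    and s: "s0 < s" "s \<le> 1"
    and dim: "\<And>n. U n \<in> carrier_vec (N - 1)"
    and scheme: "\<And>n. (1 / \<tau>) \<cdot>\<^sub>v (U (Suc n) - U n)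
        + (\<epsilon>\<^sup>2 / (2 * h)) \<cdot>\<^sub>v (stiffness_matrix s h N *\<^sub>v (U (Suc n) + U n))
        + (1 / 2) \<cdot>\<^sub>v (map_vec f (U (Suc n)) + map_vec f (U n)) = 0\<^sub>v (N - 1)"
    and init: "\<And>j. j \<in> {1..N - 1} \<Longrightarrow> U 0 $ (j - 1) = u0 (node a b N j)"
    and u0: "\<And>x. x \<in> {a<..<b} \<Longrightarrow> 0 \<le> u0 x \<and> u0 x \<le> 1"
    and tau: "0 < \<tau>" "\<tau> \<le> min 2 (h powr (2 * s) / (2 * \<epsilon>\<^sup>2))"
  shows "\<forall>n\<ge>1. \<forall>j\<in>{1..N - 1}. 0 \<le> U n $ (j - 1) \<and> U n $ (j - 1) \<le> 1"
proof -
  have hpos: "0 < h" using \<open>a < b\<close> \<open>N \<ge> 2\<close> by (simp add: h mesh_size_def)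
  have "\<forall>i<N - 1. 0 \<le> U n $ i \<and> U n $ i \<le> 1" for n
  proof (induction n)
    case 0
    show ?case
    proof (intro allI impI)
      fix i assume i: "i < N - 1"
      have "real (Suc i) < real N" using i by linarith
      then have "real (Suc i) * h < real N * h" using hpos by (intro mult_strict_right_mono) auto
      also have "real N * h = b - a" using \<open>N \<ge> 2\<close> by (simp add: h mesh_size_def)
      finally have "node a b N (Suc i) < b" by (simp add: node_def h)
      moreover have "a < node a b N (Suc i)" using hpos by (simp add: node_def h)
      ultimately show "0 \<le> U 0 $ i \<and> U 0 $ i \<le> 1"
        using init[of "Suc i"] u0 i by simp
    qed
  next
    case (Suc n)
    then show ?case
      using stiffness_step_bounds[OF hpos s dim dim scheme, of n] tau \<open>\<epsilon> > 0\<close> by simp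
  qed
  then show ?thesis by auto
qed

end
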